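(* Let $T$ be a reversible tetrahedron in $\mathbb{R}^3$ having edge lengths $a,a,b,b,c,d$, where the lengths are labelled so that the facets $f_1 \cong f_2$ have edge lengths $a,b,c$ with their common edge having length $c$, and the facets $f_3 \cong f_4$ have edge lengths $a,b,d$. Then the volume $V(T)$ of $T$ satisfies $$V(T)^2 = \frac{1}{72}\left( c^2d^2 - (a^2-b^2)^2 \right)\left( a^2 + b^2 - \frac{c^2+d^2}{2} \right).$$
   Context: A tetrahedron $T$ in $\mathbb{R}^3$ is called reversible if its four triangular facets can be labelled $f_1,f_2,f_3,f_4$ so that $f_1 \cong f_2$ and $f_3 \cong f_4$, where $\cong$ denotes congruence of triangles. For a reversible tetrahedron, the edge lengths are labelled as follows: $f_1 \cong f_2$ have edge lengths $a,b,c$, with the edge common to $f_1$ and $f_2$ having length $c$; and $f_3 \cong f_4$ have edge lengths $a,b,d$. The six edges of $T$ then have lengths $a,a,b,b,c,d$, with the edge of length $d$ being the edge common to $f_3$ and $f_4$ (opposite to the edge of length $c$). *)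

theory Defs
  imports "HOL-Analysis.Analysis" "HOL-Library.Multiset"
begin

text \<open>Congruence under Euclidean isometries of space; reflections are allowed.\<close>

definition congruent_sets :: "(real^3) set \<Rightarrow> (real^3) set \<Rightarrow> bool"  (infix "\<cong>\<^sub>E" 50)
  where "F \<cong>\<^sub>E G \<longleftrightarrow>
    (\<exists>g v. orthogonal_transformation g \<and> G = (\<lambda>x. v + g x) ` F)"

text \<open>
  A tetrahedron \<open>T\<close> is a nondegenerate \<open>3\<close>-simplex. It is reversible iff
  \<open>reversible_labelling T f1 f2 f3 f4\<close> holds for some labelling
  \<open>f1, f2, f3, f4\<close> of its four facets.
\<close>

definition reversible_labelling ::
  "(real^3) set \<Rightarrow> (real^3) set \<Rightarrow> (real^3) set \<Rightarrow> (real^3) set \<Rightarrow> (real^3) set \<Rightarrow> bool"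
  where "reversible_labelling T f1 f2 f3 f4 \<longleftrightarrow>
    3 simplex T \<and>
    distinct [f1, f2, f3, f4] \<and> {F. F facet_of T} = {f1, f2, f3, f4} \<and>
    f1 \<cong>\<^sub>E f2 \<and> f3 \<cong>\<^sub>E f4"

text \<open>An edge is a closed segment, so its diameter is its length.\<close>

definition edge_lengths :: "(real^3) set \<Rightarrow> real multiset"
  where "edge_lengths P = image_mset diameter (mset_set {e. e edge_of P})"

end

theory Submission
  imports Defs
begin

text \<open>
  Let \<open>P, Q, R, S\<close> be the vertices opposite to \<open>f1, f2, f3, f4\<close>. Comparing the perimeters of the
  facets shows that \<open>PQ\<close> has length \<open>d\<close>; cancelling \<open>c\<close> and \<open>d\<close> from the facets then shows that
  the other two pairs of opposite edges have equal lengths, namely \<open>a\<close> and \<open>b\<close>. The Gram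
  determinant of the edge vectors at \<open>S\<close> is therefore a polynomial in \<open>a, b, c, d\<close>.
\<close>

lemma diameter_closed_segment:
  fixes x y :: "'a::euclidean_space"
  shows "diameter (closed_segment x y) = dist x y"
proof (rule antisym)
  show "diameter (closed_segment x y) \<le> dist x y"
  proof (rule diameter_le)
    fix u v assume "u \<in> closed_segment x y" "v \<in> closed_segment x y"
    then show "norm (u - v) \<le> dist x y"
      by (metis dist_norm dist_decreases_closed_segment dist_in_closed_segment order_trans)
  qed auto
  show "dist x y \<le> diameter (closed_segment x y)"
    by (rule diameter_bounded_bound) (auto simp: bounded_closed_segment)
qed

text \<open>The faces of a simplex are the hulls of subsets of its vertices, and independence makes
  dimension 1 equivalent to having two vertices.\<close>

lemma edges_triangle:
  assumes "\<not> affine_dependent {x, y, z}" "distinct [x, y, z]"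
  shows "{e. e edge_of convex hull {x, y, z}} =
    {closed_segment x y, closed_segment x z, closed_segment y z}"
proof -
  have "e edge_of convex hull {x, y, z} \<longleftrightarrow>
      (\<exists>c. (c \<subseteq> {x, y, z} \<and> card c = 2) \<and> e = convex hull c)" for e
  proof -
    have "aff_dim (convex hull c) = 1 \<longleftrightarrow> card c = 2" if "c \<subseteq> {x, y, z}" for c
    proof -
      have "\<not> affine_dependent c"
        using affine_dependent_subset[OF _ that] assms(1) by blast
      then show ?thesis
        using aff_dim_affine_independent[of c] unfolding aff_dim_convex_hull by linarith
    qed
    then show ?thesis
      unfolding edge_of_def face_of_convex_hull_affine_independent[OF assms(1)] by auto
  qed
  moreover have "c \<subseteq> {x, y, z} \<and> card c = 2 \<longleftrightarrow> c = {x, y} \<or> c = {x, z} \<or> c = {y, z}" for c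
    using assms(2) by (auto simp: card_2_iff doubleton_eq_iff)
  ultimately have "e edge_of convex hull {x, y, z} \<longleftrightarrow>
      (\<exists>c\<in>{{x, y}, {x, z}, {y, z}}. e = convex hull c)" for e
    unfolding Bex_def insert_iff empty_iff by (metis (no_types))
  then have "{e. e edge_of convex hull {x, y, z}} = (hull) convex ` {{x, y}, {x, z}, {y, z}}"
    unfolding image_def by presburger
  then show ?thesis
    by (simp only: segment_convex_hull image_insert image_empty)
qed

lemma edge_lengths_triangle:
  assumes "\<not> affine_dependent {x, y, z}" "distinct [x, y, z]"
  shows "edge_lengths (convex hull {x, y, z}) = {#dist x y, dist x z, dist y z#}"
proof -
  \<comment> \<open>\<open>mset_set\<close> counts each edge once, so equal lengths get their
    multiplicity only because the three segments differ as sets.\<close>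
  have "closed_segment x y \<noteq> closed_segment x z" "closed_segment x y \<noteq> closed_segment y z"
    "closed_segment x z \<noteq> closed_segment y z"
    using assms(2) by (auto simp: doubleton_eq_iff)
  then show ?thesis
    unfolding edge_lengths_def edges_triangle[OF assms]
    by (simp add: diameter_closed_segment)
qed

text \<open>The volume is a sixth of the absolute determinant of the edge vectors at
  \<open>S\<close>, and the square of that determinant is their Gram determinant, written out
  here.\<close>

lemma measure_tetrahedron_gram:
  fixes P Q R S :: "real^3"
  assumes "distinct [P, Q, R, S]"
  defines "p \<equiv> P - S" and "q \<equiv> Q - S" and "r \<equiv> R - S"
  shows "36 * (measure lebesgue (convex hull {P, Q, R, S}))\<^sup>2 =
    (p \<bullet> p) * (q \<bullet> q) * (r \<bullet> r) + 2 * (p \<bullet> q) * (q \<bullet> r) * (p \<bullet> r)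
    - (p \<bullet> p) * (q \<bullet> r)\<^sup>2 - (q \<bullet> q) * (p \<bullet> r)\<^sup>2 - (r \<bullet> r) * (p \<bullet> q)\<^sup>2"
proof -
  define f :: "3 \<Rightarrow> real^3" where "f = (\<lambda>j. if j = 1 then P else if j = 2 then Q else R)"
  have f: "f 1 = P" "f 2 = Q" "f 3 = R"
    by (auto simp: f_def)
  have "bij_betw f UNIV ({P, Q, R, S} - {S})"
    using assms(1) unfolding bij_betw_def inj_on_def UNIV_3 by (auto simp: f)
  then have "measure lborel (convex hull {P, Q, R, S}) =
      \<bar>det (\<chi> i j. f j $ i - S $ i)\<bar> / fact CARD(3)"
    using assms(1) by (intro content_simplex) auto
  \<comment> \<open>The hull is compact, hence Borel, so completing the measure does not change its
    value.\<close>
  also have "measure lborel (convex hull {P, Q, R, S}) = measure lebesgue (convex hull {P, Q, R, S})"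
    using finite_imp_compact_convex_hull[of "{P, Q, R, S}"]
    by (intro measure_completion [symmetric]) (auto dest: compact_imp_closed)
  finally have "36 * (measure lebesgue (convex hull {P, Q, R, S}))\<^sup>2 =
      (det (\<chi> i j. f j $ i - S $ i))\<^sup>2"
    by (simp only: power_divide power2_abs) (simp add: fact_numeral)
  also have "(\<chi> i j. f j $ i - S $ i) = (\<chi> i j. (if j = 1 then p else if j = 2 then q else r) $ i)"
    by (auto simp: vec_eq_iff f_def p_def q_def r_def)
  also have "(det \<dots>)\<^sup>2 = (p \<bullet> p) * (q \<bullet> q) * (r \<bullet> r) + 2 * (p \<bullet> q) * (q \<bullet> r) * (p \<bullet> r)
    - (p \<bullet> p) * (q \<bullet> r)\<^sup>2 - (q \<bullet> q) * (p \<bullet> r)\<^sup>2 - (r \<bullet> r) * (p \<bullet> q)\<^sup>2"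
    by (simp add: det_3 inner_vec_def sum_3, algebra)
  finally show ?thesis .
qed

theorem theorem3p1:
  fixes T f1 f2 f3 f4 :: "(real^3) set" and a b c d :: real
  assumes "reversible_labelling T f1 f2 f3 f4"
    and "edge_lengths T = {#a, a, b, b, c, d#}"
    and "edge_lengths f1 = {#a, b, c#}" and "edge_lengths f2 = {#a, b, c#}"
    and "diameter (f1 \<inter> f2) = c"
    and "edge_lengths f3 = {#a, b, d#}" and "edge_lengths f4 = {#a, b, d#}"
  shows "(measure lebesgue T)\<^sup>2 =
    1 / 72 * (c\<^sup>2 * d\<^sup>2 - (a\<^sup>2 - b\<^sup>2)\<^sup>2) * (a\<^sup>2 + b\<^sup>2 - (c\<^sup>2 + d\<^sup>2) / 2)"
proof -
  from assms(1) obtain C where C: "\<not> affine_dependent C" "card C = 4" "T = convex hull C"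
    and dist_f: "distinct [f1, f2, f3, f4]" and facets: "{F. F facet_of T} = {f1, f2, f3, f4}"
    unfolding reversible_labelling_def simplex_def by auto
  \<comment> \<open>Each facet of a simplex omits exactly one vertex; this yields the vertices
    opposite to the four facets.\<close>
  have "\<exists>u\<in>C. F = convex hull (C - {u})" if "F \<in> {f1, f2, f3, f4}" for F
    using that unfolding facets[symmetric]
    by (auto simp: C(3) facet_of_convex_hull_affine_independent[OF C(1)])
  then obtain P Q R S where in_C: "P \<in> C" "Q \<in> C" "R \<in> C" "S \<in> C"
    and f: "f1 = convex hull (C - {P})" "f2 = convex hull (C - {Q})"
      "f3 = convex hull (C - {R})" "f4 = convex hull (C - {S})"
    by (metis insertCI)
  have dist: "distinct [P, Q, R, S]"
    using dist_f f by auto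
  have "finite C"
    using C(2) card.infinite by fastforce
  then have C_eq: "C = {P, Q, R, S}"
    using card_subset_eq[of C "{P, Q, R, S}"] in_C dist C(2) by auto
  have faces: "C - {P} = {Q, R, S}" "C - {Q} = {P, R, S}" "C - {R} = {P, Q, S}" "C - {S} = {P, Q, R}"
    using dist by (auto simp: C_eq)
  have indep: "\<not> affine_dependent (C - {u})" for u
    using C(1) affine_dependent_subset by blast
  have indep_Un: "\<not> affine_dependent ((C - {P}) \<union> (C - {Q}))"
    using C(1) affine_dependent_subset by blast
  \<comment> \<open>For independent vertices, hulls of subsets intersect in the hull of the common
    vertices, here the edge \<open>R S\<close>.\<close>
  have "f1 \<inter> f2 = convex hull ((C - {P}) \<inter> (C - {Q}))"
    unfolding f by (rule convex_hull_Int [symmetric]) (use indep_Un in simp)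
  also have "(C - {P}) \<inter> (C - {Q}) = {R, S}"
    using dist by (auto simp: C_eq)
  finally have RS: "dist R S = c"
    using assms(5) by (simp add: diameter_closed_segment flip: segment_convex_hull)
  have lengths: "{#dist Q R, dist Q S, dist R S#} = {#a, b, c#}"
    "{#dist P R, dist P S, dist R S#} = {#a, b, c#}"
    "{#dist P Q, dist P S, dist Q S#} = {#a, b, d#}"
    "{#dist P Q, dist P R, dist Q R#} = {#a, b, d#}"
    using assms(3,4,6,7) edge_lengths_triangle indep[of P] indep[of Q] indep[of R] indep[of S] dist
    unfolding f faces by auto
  \<comment> \<open>Adding the last two equations and subtracting the first two leaves
    \<open>2 * dist P Q = 2 * d\<close>.\<close>
  have "dist Q R + dist Q S = a + b" "dist P R + dist P S = a + b"
    "dist P Q + dist P S + dist Q S = a + b + d" "dist P Q + dist P R + dist Q R = a + b + d"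
    using lengths[THEN arg_cong[where f = sum_mset]] RS by simp_all
  then have PQ: "dist P Q = d"
    by linarith
  have pair: "x = a \<and> y = b \<or> x = b \<and> y = a" if "{#x, y, z#} = {#a, b, z#}" for x y z :: real
    using that by (auto simp: add_mset_commute[of _ z] add_eq_conv_ex)
  have "{#dist P S, dist Q S, d#} = {#a, b, d#}" "{#dist P R, dist Q R, d#} = {#a, b, d#}"
    using lengths(3,4) unfolding PQ by (simp_all add: add_mset_commute)
  \<comment> \<open>Each of the pairs \<open>QR, QS\<close>; \<open>PR, PS\<close>;
    \<open>PS, QS\<close>; \<open>PR, QR\<close> consists of \<open>a\<close> and \<open>b\<close>,
    so going round the cycle \<open>P S Q R\<close> the two lengths alternate.\<close>
  then have opp: "dist Q R = dist P S" "dist P R = dist Q S"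
      and ab: "dist P S = a \<and> dist Q S = b \<or> dist P S = b \<and> dist Q S = a"
    using pair lengths(1,2) unfolding RS by metis+
  define p q r where "p = P - S" and "q = Q - S" and "r = R - S"
  have sq: "p \<bullet> p = (dist P S)\<^sup>2" "q \<bullet> q = (dist Q S)\<^sup>2" "r \<bullet> r = c\<^sup>2"
    by (simp_all add: p_def q_def r_def dist_norm power2_norm_eq_inner flip: RS)
  \<comment> \<open>This is the law of cosines; it turns the Gram matrix into edge lengths.\<close>
  have polar: "(u - w) \<bullet> (v - w) = ((dist u w)\<^sup>2 + (dist v w)\<^sup>2 - (dist u v)\<^sup>2) / 2"
    for u v w :: "real^3"
    by (simp add: dist_norm power2_norm_eq_inner inner_commute algebra_simps)
  have prods: "p \<bullet> q = ((dist P S)\<^sup>2 + (dist Q S)\<^sup>2 - d\<^sup>2) / 2"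
    "q \<bullet> r = ((dist Q S)\<^sup>2 + c\<^sup>2 - (dist P S)\<^sup>2) / 2"
    "p \<bullet> r = ((dist P S)\<^sup>2 + c\<^sup>2 - (dist Q S)\<^sup>2) / 2"
    by (simp_all add: p_def q_def r_def polar PQ RS opp)
  \<comment> \<open>The Gram determinant is half the product of the two factors claimed. That
    product is symmetric in \<open>a\<close> and \<open>b\<close>, so both cases of
    \<open>ab\<close> give the same value.\<close>
  show ?thesis
    using measure_tetrahedron_gram[OF dist] ab
    unfolding p_def[symmetric] q_def[symmetric] r_def[symmetric] sq prods C(3) C_eq
    by (elim disjE conjE) (simp_all add: field_simps power2_eq_square)
qed

end
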